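(* Let $A \in \mathbb{R}^{s \times s}$, $B \in \mathbb{R}^{s \times a}$, $G \in \mathbb{R}^{s \times d}$, $C \in \mathbb{R}^{k \times s}$, $D \in \mathbb{R}^{k \times a}$ be fixed, and consider the norm-bounded linear differential inclusion $$\dot{x}(t) = Ax(t) + Bu(t) + Gw(t), \qquad \|w(t)\|_2 \leq \|Cx(t) + Du(t)\|_2 .$$ Let $\alpha > 0$, and let $V(x) = x^T P x$ where $P = S^{-1}$ for some symmetric $S \in \mathbb{R}^{s\times s}$, some $Y \in \mathbb{R}^{a \times s}$ and some $\mu \in \mathbb{R}$ satisfying $$\begin{bmatrix} AS + SA^T + \mu G G^T + BY + Y^TB^T + \alpha S & SC^T + Y^TD^T \\ CS + DY & -\mu I \end{bmatrix} \preceq 0, \quad S \succ 0, \quad \mu > 0 .$$ Assuming such a $P$ exists, define $$\mathcal{C}_{\text{NLDI}}(x) := \left\{ u \in \mathbb{R}^a \;\middle|\; \|Cx + Du\|_2 \leq \frac{-x^T P B}{\|G^T P x\|_2}u - \frac{x^T (2PA + \alpha P)x}{2\|G^T P x\|_2} \right\}$$ for all states $x \in \mathbb{R}^s$. Then for all $x$: (i) $\mathcal{C}_{\text{NLDI}}(x)$ is non-empty; (ii) every $u \in \mathcal{C}_{\text{NLDI}}(x)$ satisfies the exponential stability condition $\dot{V}(x) \leq -\alpha V(x)$ for every admissible disturbance, i.e. for every $w \in \mathbb{R}^d$ with $\|w\|_2 \leq \|Cx+Du\|_2$; and (iii) $\mathcal{C}_{\text{NLDI}}(x)$ is a convex set in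 $u$.
   Context: Here $x$ is the state, $u$ the control action and $w$ an unknown disturbance. For a given state $x$, action $u$ and disturbance $w$, $\dot{V}(x)$ denotes the derivative of $V$ along the dynamics, $\dot{V}(x) = \dot{x}^T P x + x^T P \dot{x}$ with $\dot{x} = Ax + Bu + Gw$. The symbols $\preceq, \succ$ refer to the semidefinite order on symmetric matrices.
   Formalization: Where G^T P x = 0 (for example at x = 0) the displayed inequality divides by zero; there the set is defined by the inequality with the denominator cleared, 0 ≤ −x^T P B u − x^T(2PA + αP)x / 2. *)

theory Defs
  imports "HOL-Analysis.Analysis"
begin

definition loewner_le :: "real ^ 'n ^ 'n \<Rightarrow> real ^ 'n ^ 'n \<Rightarrow> bool" (infix "\<preceq>\<^sub>L" 50) where
  "M \<preceq>\<^sub>L N \<longleftrightarrow> transpose M = M \<and> transpose N = N \<and> (\<forall>z. 0 \<le> z \<bullet> ((N - M) *v z))"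

definition loewner_less :: "real ^ 'n ^ 'n \<Rightarrow> real ^ 'n ^ 'n \<Rightarrow> bool" (infix "\<prec>\<^sub>L" 50) where
  "M \<prec>\<^sub>L N \<longleftrightarrow> transpose M = M \<and> transpose N = N \<and> (\<forall>z. z \<noteq> 0 \<longrightarrow> 0 < z \<bullet> ((N - M) *v z))"

definition block_matrix ::
  "real ^ 'n ^ 'm \<Rightarrow> real ^ 'q ^ 'm \<Rightarrow> real ^ 'n ^ 'p \<Rightarrow> real ^ 'q ^ 'p \<Rightarrow> real ^ ('n + 'q) ^ ('m + 'p)"
  where
  "block_matrix M11 M12 M21 M22 =
     (\<chi> i j. case i of
         Inl i' \<Rightarrow> (case j of Inl j' \<Rightarrow> M11 $ i' $ j' | Inr j' \<Rightarrow> M12 $ i' $ j')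
       | Inr i' \<Rightarrow> (case j of Inl j' \<Rightarrow> M21 $ i' $ j' | Inr j' \<Rightarrow> M22 $ i' $ j'))"

definition nldi_lmi ::
  "real ^ 's ^ 's \<Rightarrow> real ^ 'a ^ 's \<Rightarrow> real ^ 'd ^ 's \<Rightarrow> real ^ 's ^ 'k \<Rightarrow> real ^ 'a ^ 'k \<Rightarrow> real \<Rightarrow>
   real ^ 's ^ 's \<Rightarrow> real ^ 's ^ 'a \<Rightarrow> real \<Rightarrow> real ^ ('s + 'k) ^ ('s + 'k)"
  where
  "nldi_lmi A B G C D \<alpha> S Y \<mu> =
     block_matrix
       (A ** S + S ** transpose A + \<mu> *\<^sub>R (G ** transpose G) + B ** Y
          + transpose Y ** transpose B + \<alpha> *\<^sub>R S)
       (S ** transpose C + transpose Y ** transpose D)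
       (C ** S + D ** Y)
       (- (\<mu> *\<^sub>R mat 1))"

definition nldi_rhs ::
  "real ^ 's ^ 's \<Rightarrow> real ^ 'a ^ 's \<Rightarrow> real ^ 'd ^ 's \<Rightarrow>
   real ^ 's \<Rightarrow> real ^ 'a \<Rightarrow> real ^ 'd \<Rightarrow> real ^ 's"
  where
  "nldi_rhs A B G x u w = A *v x + B *v u + G *v w"

definition lyapunov_V :: "real ^ 's ^ 's \<Rightarrow> real ^ 's \<Rightarrow> real" where
  "lyapunov_V P x = x \<bullet> (P *v x)"

text \<open>The derivative of \<open>lyapunov_V P\<close> at the state \<open>x\<close> along a motion with velocity \<open>v\<close>.\<close>

definition lyapunov_Vdot :: "real ^ 's ^ 's \<Rightarrow> real ^ 's \<Rightarrow> real ^ 's \<Rightarrow> real" where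
  "lyapunov_Vdot P x v = v \<bullet> (P *v x) + x \<bullet> (P *v v)"

text \<open>
  Where \<open>G\<^sup>T P x \<noteq> 0\<close>, the defining inequality is
  \<open>\<parallel>C x + D u\<parallel> \<le> - (x\<^sup>T P B / \<parallel>G\<^sup>T P x\<parallel>) u - x\<^sup>T (2 P A + \<alpha> P) x / (2 \<parallel>G\<^sup>T P x\<parallel>)\<close>.
  Where \<open>G\<^sup>T P x = 0\<close>, this has a vanishing denominator, and the inequality is read with the
  denominator cleared, that is, multiplied through by \<open>\<parallel>G\<^sup>T P x\<parallel>\<close>.  HOL's convention
  \<open>r / 0 = 0\<close> would instead impose \<open>C x + D u = 0\<close> and drop the constraint involving \<open>P\<close>.
\<close>

definition C_NLDI ::
  "real ^ 's ^ 's \<Rightarrow> real ^ 'a ^ 's \<Rightarrow> real ^ 'd ^ 's \<Rightarrow> real ^ 's ^ 'k \<Rightarrow> real ^ 'a ^ 'k \<Rightarrow> real \<Rightarrow>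
   real ^ 's ^ 's \<Rightarrow> real ^ 's \<Rightarrow> (real ^ 'a) set"
  where
  "C_NLDI A B G C D \<alpha> P x =
     (let n = norm (transpose G *v (P *v x));
          b = x v* (P ** B);
          q = x \<bullet> ((2 *\<^sub>R (P ** A) + \<alpha> *\<^sub>R P) *v x)
      in {u. if n = 0 then 0 \<le> - (b \<bullet> u) - q / 2
             else norm (C *v x + D *v u) \<le> ((- b) /\<^sub>R n) \<bullet> u - q / (2 * n)})"

end

theory Submission
  imports Defs
begin

text \<open>
  Clearing the denominator turns the set into
  \<open>{u. x\<^sup>T (2 P A + \<alpha> P) x + 2 x\<^sup>T P B u + 2 \<parallel>G\<^sup>T P x\<parallel> \<parallel>C x + D u\<parallel> \<le> 0}\<close>.  Its left-hand side is
  convex in \<open>u\<close> and, by Cauchy-Schwarz, bounds \<open>\<dot>V + \<alpha> V\<close> over the admissible disturbances.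
  The feedback \<open>u = Y P x\<close> is a member: test the matrix inequality with the vector
  \<open>(P x, (C x + D u) / \<mu>)\<close> and use
  \<open>2 \<parallel>G\<^sup>T P x\<parallel> \<parallel>C x + D u\<parallel> \<le> \<mu> \<parallel>G\<^sup>T P x\<parallel>\<^sup>2 + \<parallel>C x + D u\<parallel>\<^sup>2 / \<mu>\<close>.
\<close>

text \<open>Matches the index type of \<open>block_matrix\<close>, so that the blocks act on
  \<open>p\<close> and \<open>v\<close> separately.\<close>

definition stack :: "real ^ 'n \<Rightarrow> real ^ 'm \<Rightarrow> real ^ ('n + 'm)" where
  "stack p v = (\<chi> i. case i of Inl j \<Rightarrow> p $ j | Inr j \<Rightarrow> v $ j)"

lemma sum_UNIV_sum_type:
  fixes f :: "'a::finite + 'b::finite \<Rightarrow> 'c::comm_monoid_add"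
  shows "(\<Sum>i\<in>UNIV. f i) = (\<Sum>i\<in>UNIV. f (Inl i)) + (\<Sum>i\<in>UNIV. f (Inr i))"
  by (simp flip: UNIV_Plus_UNIV add: sum.Plus)

lemma inner_stack: "stack p v \<bullet> stack p' v' = p \<bullet> p' + v \<bullet> v'"
  by (simp add: stack_def inner_vec_def sum_UNIV_sum_type)

lemma block_matrix_mult_stack:
  "block_matrix M11 M12 M21 M22 *v stack p v =
     stack (M11 *v p + M12 *v v) (M21 *v p + M22 *v v)"
  by (auto simp: vec_eq_iff stack_def block_matrix_def matrix_vector_mult_def
      sum_UNIV_sum_type split: sum.split)

lemma inner_vector_matrix_mult:
  fixes M :: "real ^ 'n ^ 'm"
  shows "p \<bullet> (v v* M) = v \<bullet> (M *v p)"
  by (metis dot_lmul_matrix inner_commute)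

lemma symmetric_matrix_inner:
  fixes M :: "real ^ 'n ^ 'n"
  assumes "transpose M = M"
  shows "p \<bullet> (M *v v) = v \<bullet> (M *v p)"
  by (metis assms inner_vector_matrix_mult transpose_matrix_vector)

lemma loewner_pos_imp_invertible:
  assumes "0 \<prec>\<^sub>L S"
  shows "invertible S"
proof -
  have "p = 0" if "S *v p = 0" for p
    using assms that by (force simp: loewner_less_def)
  then show ?thesis
    by (simp add: invertible_left_inverse matrix_left_invertible_ker)
qed

text \<open>Evaluates the form of the matrix inequality at \<open>stack p v\<close>. Each product
  and its transpose give the same scalar, hence the factors 2.\<close>

lemma nldi_lmi_quadratic_form:
  assumes "transpose S = S" "nldi_lmi A B G C D \<alpha> S Y \<mu> \<preceq>\<^sub>L 0"
  shows "2 * (p \<bullet> (A *v (S *v p))) + \<mu> * (norm (transpose G *v p))\<^sup>2 + 2 * (p \<bullet> (B *v (Y *v p)))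
           + \<alpha> * (p \<bullet> (S *v p)) + 2 * (v \<bullet> (C *v (S *v p) + D *v (Y *v p))) - \<mu> * (norm v)\<^sup>2 \<le> 0"
proof -
  have "stack p v \<bullet> (nldi_lmi A B G C D \<alpha> S Y \<mu> *v stack p v) \<le> 0"
    using assms(2) unfolding loewner_le_def matrix_vector_mult_diff_rdistrib
    by (simp add: inner_diff_right)
  moreover have "p \<bullet> (G *v (p v* G)) = (norm (p v* G))\<^sup>2"
    by (simp add: dot_lmul_matrix flip: dot_square_norm)
  ultimately show ?thesis
    \<comment> \<open>Symmetry of \<open>S\<close> identifies the terms of
      \<open>S ** transpose A\<close> and \<open>S ** transpose C\<close> with those of
      \<open>A ** S\<close> and \<open>C ** S\<close>.\<close>
    using symmetric_matrix_inner[OF assms(1), of p "p v* A"]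
      symmetric_matrix_inner[OF assms(1), of p "v v* C"]
    by (simp add: nldi_lmi_def block_matrix_mult_stack inner_stack matrix_vector_mult_add_rdistrib
        scaleR_matrix_vector_assoc[symmetric] matrix_vector_mul_assoc[symmetric] inner_add_right
        inner_diff_right matrix_vector_mult_diff_rdistrib[of 0, simplified]
        inner_vector_matrix_mult dot_lmul_matrix dot_square_norm)
qed

text \<open>If the norm \<open>n\<close> of \<open>transpose G *v (P *v x)\<close> is positive,
  multiply by \<open>2 * n\<close>; if it is 0, the last summand vanishes and the other branch of
  the definition remains.\<close>

lemma C_NLDI_cleared:
  "C_NLDI A B G C D \<alpha> P x =
     {u. x \<bullet> ((2 *\<^sub>R (P ** A) + \<alpha> *\<^sub>R P) *v x) + 2 * ((x v* (P ** B)) \<bullet> u)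
           + 2 * norm (transpose G *v (P *v x)) * norm (C *v x + D *v u) \<le> 0}"
proof -
  have "(m \<le> ((- b) /\<^sub>R n) \<bullet> u - q / (2 * n)) \<longleftrightarrow> q + 2 * (b \<bullet> u) + 2 * n * m \<le> 0"
    if "0 < n" for m n q :: real and b u :: "real ^ 'a"
    using that by (simp add: field_simps) argo
  then show ?thesis
    by (auto simp: C_NLDI_def Let_def)
qed

lemma convex_on_imp_convex_sublevel:
  assumes "convex_on S f"
  shows "convex {x \<in> S. f x \<le> (c::real)}"
  unfolding convex_alt
proof safe
  fix x y and t :: real
  assume *: "x \<in> S" "f x \<le> c" "y \<in> S" "f y \<le> c" "0 \<le> t" "t \<le> 1"
  then show "(1 - t) *\<^sub>R x + t *\<^sub>R y \<in> S"
    using convex_on_imp_convex[OF assms] by (simp add: convex_alt)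
  have "f ((1 - t) *\<^sub>R x + t *\<^sub>R y) \<le> (1 - t) * f x + t * f y"
    using assms * by (intro convex_onD) auto
  also have "\<dots> \<le> c"
    using * by (intro convex_bound_le) auto
  finally show "f ((1 - t) *\<^sub>R x + t *\<^sub>R y) \<le> c" .
qed

lemma convex_C_NLDI:
  fixes B :: "real ^ 'a ^ 's"
  shows "convex (C_NLDI A B G C D \<alpha> P x)"
proof -
  define n where "n = norm (transpose G *v (P *v x))"
  have "convex_on UNIV (\<lambda>u. norm (C *v x + D *v u))"
  proof (rule convex_onI)
    fix t :: real and u v :: "real ^ 'a"
    assume t: "0 < t" "t < 1"
    have "C *v x + D *v ((1 - t) *\<^sub>R u + t *\<^sub>R v)
            = (1 - t) *\<^sub>R (C *v x + D *v u) + t *\<^sub>R (C *v x + D *v v)"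
      by (simp add: algebra_simps)
    then show "norm (C *v x + D *v ((1 - t) *\<^sub>R u + t *\<^sub>R v))
                 \<le> (1 - t) * norm (C *v x + D *v u) + t * norm (C *v x + D *v v)"
      using t norm_triangle_ineq[of "(1 - t) *\<^sub>R (C *v x + D *v u)" "t *\<^sub>R (C *v x + D *v v)"]
      by simp
  qed auto
  \<comment> \<open>Scaling preserves convexity here because \<open>n\<close>, being a norm, is
    nonnegative.\<close>
  then have "convex_on UNIV (\<lambda>u. 2 * n * norm (C *v x + D *v u))"
    by (intro convex_on_cmul) (auto simp: n_def)
  moreover have "convex_on UNIV (\<lambda>u. q + 2 * (b \<bullet> u))" for q :: real and b :: "real ^ 'a"
    by (rule convex_onI) (auto simp: inner_add_right algebra_simps)
  ultimately have "convex_on UNIV (\<lambda>u. q + 2 * (b \<bullet> u) + 2 * n * norm (C *v x + D *v u))"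
    for q b
    by (rule convex_on_add[rotated])
  from convex_on_imp_convex_sublevel[OF this] show ?thesis
    unfolding C_NLDI_cleared n_def by simp
qed

lemma C_NLDI_stable:
  assumes P: "transpose P = P" and u: "u \<in> C_NLDI A B G C D \<alpha> P x"
    and w: "norm w \<le> norm (C *v x + D *v u)"
  shows "lyapunov_Vdot P x (nldi_rhs A B G x u w) \<le> - \<alpha> * lyapunov_V P x"
proof -
  let ?g = "transpose G *v (P *v x)"
  note swap = symmetric_matrix_inner[OF P]
  \<comment> \<open>By symmetry of \<open>P\<close>, twice this scalar is the only part of the
    derivative that depends on \<open>w\<close>.\<close>
  have "x \<bullet> (P *v (G *v w)) = ?g \<bullet> w"
    by (simp add: dot_lmul_matrix swap[of x] inner_commute[of "G *v w"])
  also have "\<dots> \<le> norm ?g * norm w"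
    by (rule norm_cauchy_schwarz)
  also have "\<dots> \<le> norm ?g * norm (C *v x + D *v u)"
    using w by (intro mult_left_mono) auto
  finally show ?thesis
    using u
    by (simp add: C_NLDI_cleared lyapunov_Vdot_def lyapunov_V_def nldi_rhs_def
        swap[of "_ + _" x] matrix_vector_right_distrib matrix_vector_mult_add_rdistrib inner_add_right dot_lmul_matrix
        scaleR_matrix_vector_assoc[symmetric] matrix_vector_mul_assoc[symmetric])
qed

lemma feedback_in_C_NLDI:
  assumes S: "transpose S = S" and lmi: "nldi_lmi A B G C D \<alpha> S Y \<mu> \<preceq>\<^sub>L 0" and "\<mu> > 0"
    and P: "transpose P = P" and SP: "S ** P = mat 1"
  shows "Y *v (P *v x) \<in> C_NLDI A B G C D \<alpha> P x"
proof -
  define p where "p = P *v x"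
  define u where "u = Y *v p"
  define c where "c = C *v x + D *v u"
  define g where "g = norm (transpose G *v p)"
  have x: "S *v p = x"
    by (simp add: p_def matrix_vector_mul_assoc SP)
  \<comment> \<open>The vector \<open>c /\<^sub>R \<mu>\<close> maximizes
    \<open>2 * (v \<bullet> c) - \<mu> * (norm v)\<^sup>2\<close> over \<open>v\<close>; inserting
    it amounts to taking the Schur complement of the lower right block.\<close>
  have "2 * ((c /\<^sub>R \<mu>) \<bullet> c) - \<mu> * (norm (c /\<^sub>R \<mu>))\<^sup>2 = (norm c)\<^sup>2 / \<mu>"
    using \<open>\<mu> > 0\<close> by (simp add: dot_square_norm power2_eq_square field_simps)
  then have "2 * (p \<bullet> (A *v x)) + \<mu> * g\<^sup>2 + 2 * (p \<bullet> (B *v u)) + \<alpha> * (p \<bullet> x)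
          + (norm c)\<^sup>2 / \<mu> \<le> 0"
    using nldi_lmi_quadratic_form[OF S lmi, of p "c /\<^sub>R \<mu>"]
    unfolding x u_def[symmetric] c_def[symmetric] g_def[symmetric] by linarith
  moreover have "2 * g * norm c \<le> \<mu> * g\<^sup>2 + (norm c)\<^sup>2 / \<mu>"
  proof -
    have "0 \<le> (\<mu> * g - norm c)\<^sup>2 / \<mu>"
      using \<open>\<mu> > 0\<close> by simp
    then show ?thesis
      using \<open>\<mu> > 0\<close> by (simp add: power2_eq_square field_simps)
  qed
  ultimately have "2 * (p \<bullet> (A *v x)) + 2 * (p \<bullet> (B *v u)) + \<alpha> * (p \<bullet> x) + 2 * g * norm c \<le> 0"
    by linarith
  moreover have "x \<bullet> (P *v v) = p \<bullet> v" for v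
    using symmetric_matrix_inner[OF P, of x v] by (simp add: p_def inner_commute)
  ultimately have "x \<bullet> ((2 *\<^sub>R (P ** A) + \<alpha> *\<^sub>R P) *v x) + 2 * ((x v* (P ** B)) \<bullet> u)
      + 2 * g * norm c \<le> 0"
    by (simp add: matrix_vector_mult_add_rdistrib inner_add_right dot_lmul_matrix
        scaleR_matrix_vector_assoc[symmetric] matrix_vector_mul_assoc[symmetric])
  then show ?thesis
    unfolding C_NLDI_cleared g_def c_def u_def p_def by simp
qed

theorem theorem1:
  fixes A :: "real ^ 's ^ 's" and B :: "real ^ 'a ^ 's" and G :: "real ^ 'd ^ 's"
    and C :: "real ^ 's ^ 'k" and D :: "real ^ 'a ^ 'k"
    and S P :: "real ^ 's ^ 's" and Y :: "real ^ 's ^ 'a" and \<alpha> \<mu> :: real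
  assumes "\<alpha> > 0"
    and "transpose S = S"
    and "nldi_lmi A B G C D \<alpha> S Y \<mu> \<preceq>\<^sub>L 0"
    and "0 \<prec>\<^sub>L S"
    and "\<mu> > 0"
    and "P = matrix_inv S"
  shows "\<forall>x. C_NLDI A B G C D \<alpha> P x \<noteq> {}
           \<and> (\<forall>u \<in> C_NLDI A B G C D \<alpha> P x. \<forall>w. norm w \<le> norm (C *v x + D *v u) \<longrightarrow>
                 lyapunov_Vdot P x (nldi_rhs A B G x u w) \<le> - \<alpha> * lyapunov_V P x)
           \<and> convex (C_NLDI A B G C D \<alpha> P x)"
proof -
  \<comment> \<open>\<open>matrix_inv\<close> is a choice, which yields a two-sided inverse once one
    exists.\<close>
  have "S ** P = mat 1 \<and> P ** S = mat 1"
    unfolding assms(6) matrix_inv_def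
    using loewner_pos_imp_invertible[OF assms(4)] unfolding invertible_def by (rule someI_ex)
  then have SP: "S ** P = mat 1" ..
  have "transpose P ** S = mat 1"
    by (metis SP assms(2) matrix_transpose_mul transpose_mat)
  \<comment> \<open>A left inverse and a right inverse of \<open>S\<close> coincide.\<close>
  then have P: "transpose P = P"
    by (metis SP matrix_mul_assoc matrix_mul_lid matrix_mul_rid)
  show ?thesis
    using feedback_in_C_NLDI[OF assms(2,3,5) P SP] C_NLDI_stable[OF P] convex_C_NLDI by blast
qed

end
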